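(* Let $n\ge 1$, let $\mathcal{Z}=\mathcal{Z}_1\times\dots\times\mathcal{Z}_n$ be a product of measurable spaces, let $S=(X_1,\dots,X_n)$ be a random element of $\mathcal{Z}$ with mutually independent coordinates, and let $f:\mathcal{Z}\to\mathbb{R}$ be measurable with $\mathbb{E}[f(S)^2]<\infty$. Let $\Delta=f(S)-\mathbb{E}[f(S)]$ and let $V$ be the semi-empirical Efron–Stein variance proxy \[ V=\sum_{k=1}^n \mathbb{E}\big[(f(S)-f(S^{(k)}))^2 \,\big|\, X_1,\dots,X_k\big]. \] Then: (i) for every $y>0$ and every $x\ge 2$, \[ \mathbb{P}\Big(|\Delta|\le \sqrt{2(V+y)\big(1+\tfrac12\ln(1+V/y)\big)x}\Big)\ge 1-e^{-x}; \] (ii) for every $x>0$, \[ \mathbb{P}\Big(|\Delta|\le 2\sqrt{(V+\mathbb{E}[V])\,x}\Big)\ge 1-\sqrt2\, e^{-x}. \]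
   Context: $S'=(X_1',\dots,X_n')$ denotes an independent copy of $S$ (independent of $S$, with the same distribution), and $S^{(k)}$ denotes the tuple obtained from $S$ by replacing its $k$-th coordinate $X_k$ by $X_k'$. *)

theory Defs
  imports "HOL-Probability.Probability"
begin

text \<open>Coordinates are indexed by 0..<n (the paper's 1..n shifted by one).
  The sample S is the tuple of the X i, as an element of PiM {..<n} N.\<close>

definition sample :: "nat \<Rightarrow> (nat \<Rightarrow> 'w \<Rightarrow> 'a) \<Rightarrow> 'w \<Rightarrow> (nat \<Rightarrow> 'a)" where
  "sample n X \<omega> = (\<lambda>i\<in>{..<n}. X i \<omega>)"

definition sample_repl :: "nat \<Rightarrow> (nat \<Rightarrow> 'w \<Rightarrow> 'a) \<Rightarrow> (nat \<Rightarrow> 'w \<Rightarrow> 'a) \<Rightarrow> nat \<Rightarrow> 'w \<Rightarrow> (nat \<Rightarrow> 'a)" where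
  "sample_repl n X X' k \<omega> = (\<lambda>i\<in>{..<n}. if i = k then X' i \<omega> else X i \<omega>)"

definition hist_algebra :: "'w measure \<Rightarrow> (nat \<Rightarrow> 'a measure) \<Rightarrow> (nat \<Rightarrow> 'w \<Rightarrow> 'a) \<Rightarrow> nat \<Rightarrow> 'w measure" where
  "hist_algebra M N X k =
     sigma (space M) {X i -` A \<inter> space M | i A. i \<le> k \<and> A \<in> sets (N i)}"

definition es_proxy :: "'w measure \<Rightarrow> (nat \<Rightarrow> 'a measure) \<Rightarrow> nat \<Rightarrow> ((nat \<Rightarrow> 'a) \<Rightarrow> real)
    \<Rightarrow> (nat \<Rightarrow> 'w \<Rightarrow> 'a) \<Rightarrow> (nat \<Rightarrow> 'w \<Rightarrow> 'a) \<Rightarrow> 'w \<Rightarrow> real" where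
  "es_proxy M N n f X X' \<omega> =
     (\<Sum>k<n. real_cond_exp M (hist_algebra M N X k)
        (\<lambda>\<eta>. (f (sample n X \<eta>) - f (sample_repl n X X' k \<eta>))\<^sup>2) \<omega>)"

end

theory Submission
  imports Defs
begin

text \<open>
  Write \<open>F k\<close> for the history up to index \<open>k\<close>, \<open>Y k = f S - f S\<^sup>(\<^sup>k\<^sup>)\<close> and \<open>D k = E[Y k | F k]\<close>. Since
  \<open>E[f S\<^sup>(\<^sup>k\<^sup>) | F k] = E[f S | F (k - 1)]\<close>, the \<open>D k\<close> are the Doob martingale differences of \<open>f S\<close>.
  Jensen's inequality bounds \<open>exp (l D k - l\<^sup>2 E[(Y k)\<^sup>2 | F k] / 2)\<close> by
  \<open>E[exp (l Y k - l\<^sup>2 (Y k)\<^sup>2 / 2) | F k]\<close>, and as \<open>Y k\<close> is symmetric given \<open>F (k - 1)\<close>, the inequality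
  \<open>cosh z \<le> exp (z\<^sup>2 / 2)\<close> bounds the conditional mean of the latter given \<open>F (k - 1)\<close> by \<open>1\<close>.
  Hence \<open>E exp (l \<Delta> - l\<^sup>2 V / 2) \<le> 1\<close> for every real \<open>l\<close>. Integrating over a Gaussian \<open>l\<close> gives
  \<open>E [sqrt (y / (V + y)) exp (\<Delta>\<^sup>2 / (2 (V + y)))] \<le> 1\<close>. Markov's inequality then yields (i), and with
  \<open>y = E V\<close> the Cauchy-Schwarz inequality followed by Markov's inequality yields (ii).
\<close>

section \<open>Elementary inequalities and a Gaussian integral\<close>

lemma cosh_le_exp_half_square: "cosh z \<le> exp (z\<^sup>2 / 2)" for z :: real
proof -
  have nonneg: "cosh z \<le> exp (z\<^sup>2 / 2)" if "z \<ge> 0" for z :: real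
  proof -
    \<comment> \<open>The left side is \<open>ln (cosh z)\<close>, the log-moment generating
      function of a random sign. Hoeffding's estimate \<open>h\<^sup>2 / 8\<close> with
      \<open>h = 2 * z\<close> and weight \<open>1 / 2\<close> gives exactly
      \<open>z\<^sup>2 / 2\<close>. It requires \<open>h \<ge> 0\<close>; evenness of
      \<open>cosh\<close> covers negative \<open>z\<close>.\<close>
    have "- (2 * z) * (1 / 2) + ln (1 + 1 / 2 * (exp (2 * z) - 1)) \<le> (2 * z)\<^sup>2 / 8"
      using that by (intro Hoeffdings_lemma_aux) auto
    then have "exp (- z + ln ((1 + exp (2 * z)) / 2)) \<le> exp (z\<^sup>2 / 2)"
      by (simp add: field_simps power2_eq_square)
    moreover have "exp (- z + ln ((1 + exp (2 * z)) / 2)) = cosh z"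
    proof -
      have "(1 + exp (2 * z)) / 2 > 0" by (simp add: add_pos_pos)
      then have "exp (- z + ln ((1 + exp (2 * z)) / 2)) = exp (- z) * ((1 + exp (2 * z)) / 2)"
        by (simp only: exp_add exp_ln)
      also have "\<dots> = cosh z"
        by (simp add: cosh_field_def distrib_left flip: exp_add)
      finally show ?thesis .
    qed
    ultimately show ?thesis by (simp only:)
  qed
  show ?thesis using nonneg[of z] nonneg[of "- z"] by (cases "z \<ge> 0") auto
qed

text \<open>By completing the square. The bound is uniform in \<open>l\<close> and \<open>y\<close>,
  so the exponentials of the martingale argument are integrable although \<open>f\<close> has only a
  second moment.\<close>

lemma exp_quadratic_le: "exp (l * y - l\<^sup>2 * y\<^sup>2 / 2) \<le> exp (1 / 2)" for l y :: real
proof -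
  have "0 \<le> (l * y - 1)\<^sup>2" by simp
  then show ?thesis by (simp add: power2_eq_square algebra_simps)
qed

text \<open>Completing the square makes the integrand a constant multiple of the normal density with
  mean \<open>d / (v + y)\<close> and variance \<open>1 / (v + y)\<close>. The factor
  \<open>sqrt (y / (v + y))\<close> is the ratio of the two normalising constants.\<close>

lemma nn_integral_normal_density_exp_quadratic:
  fixes y v d :: real
  assumes "y > 0" "v \<ge> 0"
  shows "(\<integral>\<^sup>+ l. ennreal (normal_density 0 (1 / sqrt y) l * exp (l * d - l\<^sup>2 * v / 2)) \<partial>lborel)
       = ennreal (sqrt (y / (v + y)) * exp (d\<^sup>2 / (2 * (v + y))))" (is "_ = ennreal ?c")
proof -
  have pos: "v + y > 0" using assms by simp
  have "normal_density 0 (1 / sqrt y) l * exp (l * d - l\<^sup>2 * v / 2)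
      = ?c * normal_density (d / (v + y)) (1 / sqrt (v + y)) l" for l
  proof -
    have "- l\<^sup>2 * y / 2 + (l * d - l\<^sup>2 * v / 2)
        = d\<^sup>2 / (2 * (v + y)) + (- (l - d / (v + y))\<^sup>2 * (v + y) / 2)"
    proof -
      define c where "c = d / (v + y)"
      have "d = c * (v + y)" using pos by (simp add: c_def)
      then have "d\<^sup>2 / (2 * (v + y)) = c\<^sup>2 * (v + y) / 2"
        using pos by (simp add: power2_eq_square del: distrib_left_numeral)
      moreover have "- l\<^sup>2 * y / 2 + (l * d - l\<^sup>2 * v / 2) = c\<^sup>2 * (v + y) / 2 + (- (l - c)\<^sup>2 * (v + y) / 2)"
        unfolding \<open>d = c * (v + y)\<close> by (simp add: field_simps power2_eq_square)
      ultimately show ?thesis by (simp only: c_def)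
    qed
    then have "exp (- l\<^sup>2 * y / 2) * exp (l * d - l\<^sup>2 * v / 2)
        = exp (d\<^sup>2 / (2 * (v + y))) * exp (- (l - d / (v + y))\<^sup>2 * (v + y) / 2)"
      by (simp flip: exp_add)
    moreover have "normal_density 0 (1 / sqrt y) l = sqrt (y / (2 * pi)) * exp (- l\<^sup>2 * y / 2)"
      using assms by (simp add: normal_density_def power_divide real_sqrt_divide)
    moreover have "normal_density (d / (v + y)) (1 / sqrt (v + y)) l
        = sqrt ((v + y) / (2 * pi)) * exp (- (l - d / (v + y))\<^sup>2 * (v + y) / 2)"
      using pos by (simp add: normal_density_def power_divide real_sqrt_divide)
    moreover have "sqrt (y / (2 * pi)) = sqrt (y / (v + y)) * sqrt ((v + y) / (2 * pi))"
      using pos by (simp add: real_sqrt_divide)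
    ultimately show ?thesis by (simp add: mult_ac)
  qed
  then have "(\<integral>\<^sup>+ l. ennreal (normal_density 0 (1 / sqrt y) l * exp (l * d - l\<^sup>2 * v / 2)) \<partial>lborel)
     = (\<integral>\<^sup>+ l. ennreal ?c * ennreal (normal_density (d / (v + y)) (1 / sqrt (v + y)) l) \<partial>lborel)"
    using assms by (simp add: ennreal_mult)
  also have "\<dots> = ennreal ?c * 1"
    using pos by (subst nn_integral_cmult) (simp_all add: nn_integral_eq_integral)
  finally show ?thesis by simp
qed

section \<open>Deviation bounds for a pair satisfying the exponential inequality\<close>

context prob_space
begin

lemma prob_le_exp_ge:
  fixes u :: "'a \<Rightarrow> real"
  assumes [measurable]: "u \<in> borel_measurable M" and "C \<ge> 0"
    and "(\<integral>\<^sup>+ \<omega>. ennreal (u \<omega>) \<partial>M) \<le> ennreal C"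
  shows "prob {\<omega> \<in> space M. u \<omega> \<le> exp x} \<ge> 1 - C * exp (- x)"
proof -
  have "emeasure M {\<omega> \<in> space M. 1 \<le> ennreal (exp (- x)) * ennreal (u \<omega>)}
      \<le> ennreal (exp (- x)) * (\<integral>\<^sup>+ \<omega>. ennreal (u \<omega>) * indicator (space M) \<omega> \<partial>M)"
    by (rule nn_integral_Markov_inequality) auto
  also have "(\<integral>\<^sup>+ \<omega>. ennreal (u \<omega>) * indicator (space M) \<omega> \<partial>M) = (\<integral>\<^sup>+ \<omega>. ennreal (u \<omega>) \<partial>M)"
    by (intro nn_integral_cong) auto
  also have "ennreal (exp (- x)) * (\<integral>\<^sup>+ \<omega>. ennreal (u \<omega>) \<partial>M) \<le> ennreal (exp (- x)) * ennreal C"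
    by (intro mult_left_mono assms) auto
  finally have *: "prob {\<omega> \<in> space M. 1 \<le> ennreal (exp (- x)) * ennreal (u \<omega>)} \<le> C * exp (- x)"
    using \<open>C \<ge> 0\<close> by (simp add: emeasure_eq_measure mult.commute flip: ennreal_mult)
  have "{\<omega> \<in> space M. u \<omega> > exp x} \<subseteq> {\<omega> \<in> space M. 1 \<le> ennreal (exp (- x)) * ennreal (u \<omega>)}"
  proof safe
    fix \<omega> assume "u \<omega> > exp x"
    then have "exp (- x) * exp x \<le> exp (- x) * u \<omega>" by simp
    then have "1 \<le> exp (- x) * u \<omega>" by (simp flip: exp_add)
    then show "1 \<le> ennreal (exp (- x)) * ennreal (u \<omega>)" by (simp flip: ennreal_mult')
  qed
  then have "prob {\<omega> \<in> space M. u \<omega> > exp x} \<le> C * exp (- x)"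
    by (intro order_trans[OF finite_measure_mono *]) auto
  moreover have "prob {\<omega> \<in> space M. \<not> u \<omega> > exp x} = 1 - prob {\<omega> \<in> space M. u \<omega> > exp x}"
    by (rule prob_neg) auto
  ultimately show ?thesis by (simp add: not_less)
qed

text \<open>Averaging the exponential inequality over a centred Gaussian \<open>l\<close> of variance \<open>1 / y\<close>.\<close>

lemma canonical_pair_mixture:
  fixes D V :: "'a \<Rightarrow> real"
  assumes [measurable]: "D \<in> borel_measurable M" "V \<in> borel_measurable M"
    and V: "AE \<omega> in M. V \<omega> \<ge> 0"
    and canonical: "\<And>l. (\<integral>\<^sup>+ \<omega>. ennreal (exp (l * D \<omega> - l\<^sup>2 * V \<omega> / 2)) \<partial>M) \<le> 1"
    and y: "y > 0"
  shows "(\<integral>\<^sup>+ \<omega>. ennreal (sqrt (y / (V \<omega> + y)) * exp ((D \<omega>)\<^sup>2 / (2 * (V \<omega> + y)))) \<partial>M) \<le> 1"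
proof -
  interpret pair_sigma_finite lborel M ..
  let ?N = "normal_density 0 (1 / sqrt y)"
  have "(\<integral>\<^sup>+ \<omega>. ennreal (sqrt (y / (V \<omega> + y)) * exp ((D \<omega>)\<^sup>2 / (2 * (V \<omega> + y)))) \<partial>M)
      = (\<integral>\<^sup>+ \<omega>. \<integral>\<^sup>+ l. ennreal (?N l * exp (l * D \<omega> - l\<^sup>2 * V \<omega> / 2)) \<partial>lborel \<partial>M)"
    using V by (intro nn_integral_cong_AE)
      (auto elim!: eventually_mono simp: nn_integral_normal_density_exp_quadratic[OF y])
  also have "\<dots> = (\<integral>\<^sup>+ l. \<integral>\<^sup>+ \<omega>. ennreal (?N l * exp (l * D \<omega> - l\<^sup>2 * V \<omega> / 2)) \<partial>M \<partial>lborel)"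
    by (rule Fubini') measurable
  also have "\<dots> = (\<integral>\<^sup>+ l. ennreal (?N l) * (\<integral>\<^sup>+ \<omega>. ennreal (exp (l * D \<omega> - l\<^sup>2 * V \<omega> / 2)) \<partial>M) \<partial>lborel)"
    by (intro nn_integral_cong) (simp add: ennreal_mult' nn_integral_cmult)
  also have "\<dots> \<le> (\<integral>\<^sup>+ l. ennreal (?N l) * 1 \<partial>lborel)"
    by (intro nn_integral_mono mult_left_mono canonical) auto
  also have "\<dots> = 1"
    using y by (simp add: nn_integral_eq_integral)
  finally show ?thesis .
qed

text \<open>Markov's inequality at level \<open>exp x\<close> for the Gaussian mixture, solved for
  \<open>D\<close>. The logarithm in the bound comes from the factor
  \<open>sqrt (y / (V + y))\<close> of the mixture.\<close>

lemma canonical_pair_log_deviation: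
  fixes D V :: "'a \<Rightarrow> real"
  assumes [measurable]: "D \<in> borel_measurable M" "V \<in> borel_measurable M"
    and V: "AE \<omega> in M. V \<omega> \<ge> 0"
    and canonical: "\<And>l. (\<integral>\<^sup>+ \<omega>. ennreal (exp (l * D \<omega> - l\<^sup>2 * V \<omega> / 2)) \<partial>M) \<le> 1"
    and y: "y > 0" and x: "x \<ge> 1"
  shows "prob {\<omega> \<in> space M. \<bar>D \<omega>\<bar> \<le> sqrt (2 * (V \<omega> + y) * (1 + ln (1 + V \<omega> / y) / 2) * x)}
           \<ge> 1 - exp (- x)"
proof -
  let ?u = "\<lambda>\<omega>. sqrt (y / (V \<omega> + y)) * exp ((D \<omega>)\<^sup>2 / (2 * (V \<omega> + y)))"
  have "prob {\<omega> \<in> space M. ?u \<omega> \<le> exp x} \<ge> 1 - 1 * exp (- x)"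
    using canonical_pair_mixture[OF assms(1-5)] by (intro prob_le_exp_ge) auto
  also have "prob {\<omega> \<in> space M. ?u \<omega> \<le> exp x} \<le>
     prob {\<omega> \<in> space M. \<bar>D \<omega>\<bar> \<le> sqrt (2 * (V \<omega> + y) * (1 + ln (1 + V \<omega> / y) / 2) * x)}"
  \<comment> \<open>The inclusion of events is claimed only almost everywhere, because
    \<open>V\<close> is nonnegative only almost everywhere.\<close>
  proof (rule finite_measure_mono_AE)
    show "AE \<omega> in M. \<omega> \<in> {\<omega> \<in> space M. ?u \<omega> \<le> exp x} \<longrightarrow>
      \<omega> \<in> {\<omega> \<in> space M. \<bar>D \<omega>\<bar> \<le> sqrt (2 * (V \<omega> + y) * (1 + ln (1 + V \<omega> / y) / 2) * x)}"
      using V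
    proof (rule eventually_mono, safe)
      fix \<omega> assume v: "V \<omega> \<ge> 0" and le: "?u \<omega> \<le> exp x"
      define w where "w = V \<omega> + y"
      define L where "L = ln (1 + V \<omega> / y)"
      have w: "w > 0" using v y by (simp add: w_def)
      have "L \<ge> 0" using v y by (simp add: L_def)
      have "y / w > 0" using y w by simp
      have "ln (?u \<omega>) \<le> x"
        using le y w by (subst ln_le_cancel_iff[of _ "exp x", simplified]) (auto simp: w_def)
      moreover have "ln (?u \<omega>) = ln (y / w) / 2 + (D \<omega>)\<^sup>2 / (2 * w)"
        using \<open>y / w > 0\<close> y w by (simp add: w_def[symmetric] ln_mult ln_sqrt)
      moreover have "ln (y / w) = - L"
        using y w by (simp add: L_def w_def ln_div add_divide_distrib[symmetric] add.commute field_simps)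
      ultimately have "(D \<omega>)\<^sup>2 / (2 * w) \<le> x + L / 2" by simp
      \<comment> \<open>Here \<open>x \<ge> 1\<close> turns the additive term \<open>L / 2\<close>
        into a multiple of \<open>x\<close>.\<close>
      also have "\<dots> \<le> x + L / 2 * x"
        using \<open>L \<ge> 0\<close> x by (simp add: mult_left_mono[of 1 x L, simplified])
      finally have "(D \<omega>)\<^sup>2 \<le> 2 * w * (1 + L / 2) * x"
        using w by (simp add: field_simps)
      then show "\<bar>D \<omega>\<bar> \<le> sqrt (2 * (V \<omega> + y) * (1 + ln (1 + V \<omega> / y) / 2) * x)"
        unfolding w_def L_def by (simp add: real_le_rsqrt)
    qed
  qed measurable
  finally show ?thesis by simp
qed

text \<open>Taking \<open>y = expectation V\<close> in the mixture, Cauchy-Schwarz removes the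
  random factor \<open>sqrt (y / (V + y))\<close> at the price of halving the exponent. The mixture
  needs \<open>y > 0\<close>, so the case of vanishing expectation is treated separately.\<close>

lemma canonical_pair_expectation_deviation:
  fixes D V :: "'a \<Rightarrow> real"
  assumes [measurable]: "D \<in> borel_measurable M" and int: "integrable M V"
    and V: "AE \<omega> in M. V \<omega> \<ge> 0"
    and canonical: "\<And>l. (\<integral>\<^sup>+ \<omega>. ennreal (exp (l * D \<omega> - l\<^sup>2 * V \<omega> / 2)) \<partial>M) \<le> 1"
    and x: "x \<ge> 0"
  shows "prob {\<omega> \<in> space M. \<bar>D \<omega>\<bar> \<le> 2 * sqrt ((V \<omega> + expectation V) * x)} \<ge> 1 - sqrt 2 * exp (- x)"
proof (cases "expectation V = 0")
  case True
  have [measurable]: "V \<in> borel_measurable M" using int by auto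
  have V0: "AE \<omega> in M. V \<omega> = 0"
    using True integral_nonneg_eq_0_iff_AE[OF int V] by simp
  \<comment> \<open>As \<open>V\<close> vanishes almost everywhere, the quadratic term drops out.
    Taking \<open>l = 1\<close> and \<open>l = - 1\<close> shows that \<open>cosh D\<close> has mean
    at most 1; since \<open>cosh\<close> is at least 1, with equality only at 0, \<open>D\<close>
    vanishes almost everywhere.\<close>
  have exp_le: "(\<integral>\<^sup>+ \<omega>. ennreal (exp (l * D \<omega>)) \<partial>M) \<le> 1" for l
  proof -
    have "(\<integral>\<^sup>+ \<omega>. ennreal (exp (l * D \<omega>)) \<partial>M) = (\<integral>\<^sup>+ \<omega>. ennreal (exp (l * D \<omega> - l\<^sup>2 * V \<omega> / 2)) \<partial>M)"
      using V0 by (intro nn_integral_cong_AE) auto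
    with canonical show ?thesis by simp
  qed
  have int_exp: "integrable M (\<lambda>\<omega>. exp (l * D \<omega>))" for l
    using exp_le[of l] by (intro integrableI_nonneg) (auto simp: less_top[symmetric] top_unique)
  have "expectation (\<lambda>\<omega>. exp (l * D \<omega>)) \<le> 1" for l
    using exp_le[of l] by (simp add: nn_integral_eq_integral[OF int_exp])
  from this[of 1] this[of "- 1"] have "expectation (\<lambda>\<omega>. exp (D \<omega>) + exp (- D \<omega>)) \<le> 2"
    using int_exp[of 1] int_exp[of "- 1"] by simp
  then have le0: "expectation (\<lambda>\<omega>. exp (D \<omega>) + exp (- D \<omega>) - 2) \<le> 0"
    using int_exp[of 1] int_exp[of "- 1"] by (simp add: prob_space)
  have pos: "exp d + exp (- d) - 2 \<ge> 0" for d :: real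
    using cosh_real_ge_1[of d] by (simp add: cosh_field_def)
  have "integrable M (\<lambda>\<omega>. exp (D \<omega>) + exp (- D \<omega>) - 2)"
    using int_exp[of 1] int_exp[of "- 1"] by simp
  moreover have "expectation (\<lambda>\<omega>. exp (D \<omega>) + exp (- D \<omega>) - 2) = 0"
    using le0 pos by (intro antisym) (auto intro: integral_nonneg_AE)
  ultimately have "AE \<omega> in M. exp (D \<omega>) + exp (- D \<omega>) - 2 = 0"
    using pos by (subst (asm) integral_nonneg_eq_0_iff_AE) auto
  then have "AE \<omega> in M. cosh (D \<omega>) = 1"
    by (auto simp: cosh_field_def elim!: eventually_mono)
  then have D0: "AE \<omega> in M. D \<omega> = 0"
    by (auto elim!: eventually_mono)
  have "prob {\<omega> \<in> space M. \<bar>D \<omega>\<bar> \<le> 2 * sqrt ((V \<omega> + expectation V) * x)} = 1"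
    using D0 V0 x True by (intro prob_eq_1[THEN iffD2]) auto
  then show ?thesis by simp
next
  case False
  define y where "y = expectation V"
  have "y \<ge> 0" unfolding y_def by (rule integral_nonneg_AE[OF V])
  with False have y: "y > 0" by (simp add: y_def)
  have [measurable]: "V \<in> borel_measurable M" using int by auto
  let ?u = "\<lambda>\<omega>. exp ((D \<omega>)\<^sup>2 / (4 * (V \<omega> + y)))"
  let ?r = "\<lambda>\<omega>. sqrt (y / (V \<omega> + y)) * exp ((D \<omega>)\<^sup>2 / (2 * (V \<omega> + y)))"
  \<comment> \<open>The exponential \<open>?u\<close> is split as \<open>?a * ?b\<close>: the square
    of \<open>?a\<close> is the mixture integrand \<open>?r\<close>, whose mean is at most 1, and
    \<open>?b\<close> undoes the square root of its prefactor.\<close>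
  let ?a = "\<lambda>\<omega>. ennreal (sqrt (?r \<omega>))"
  let ?b = "\<lambda>\<omega>. ennreal (sqrt (sqrt ((V \<omega> + y) / y)))"
  have "(\<integral>\<^sup>+ \<omega>. ennreal (?u \<omega>) \<partial>M)\<^sup>2 = (\<integral>\<^sup>+ \<omega>. ?a \<omega> * ?b \<omega> \<partial>M)\<^sup>2"
  proof (intro arg_cong[where f="\<lambda>z. z\<^sup>2"] nn_integral_cong_AE eventually_mono[OF V])
    fix \<omega> assume v: "V \<omega> \<ge> 0"
    have "exp ((D \<omega>)\<^sup>2 / (2 * (V \<omega> + y))) = (?u \<omega>)\<^sup>2"
      using v y by (simp add: field_simps flip: exp_double)
    then have "sqrt (?r \<omega>) * sqrt (sqrt ((V \<omega> + y) / y)) = ?u \<omega>"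
      using v y by (simp add: real_sqrt_mult real_sqrt_divide)
    then show "ennreal (?u \<omega>) = ?a \<omega> * ?b \<omega>"
      using v y by (simp flip: ennreal_mult)
  qed
  also have "\<dots> \<le> (\<integral>\<^sup>+ \<omega>. (?a \<omega>)\<^sup>2 \<partial>M) * (\<integral>\<^sup>+ \<omega>. (?b \<omega>)\<^sup>2 \<partial>M)"
    by (rule Cauchy_Schwarz_nn_integral) measurable
  also have "(\<integral>\<^sup>+ \<omega>. (?a \<omega>)\<^sup>2 \<partial>M) = (\<integral>\<^sup>+ \<omega>. ennreal (?r \<omega>) \<partial>M)"
  proof (intro nn_integral_cong_AE eventually_mono[OF V])
    fix \<omega> assume "V \<omega> \<ge> 0"
    with y have "?r \<omega> \<ge> 0" by simp
    then show "(?a \<omega>)\<^sup>2 = ennreal (?r \<omega>)" by (subst ennreal_power) auto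
  qed
  also have "(\<integral>\<^sup>+ \<omega>. ennreal (?r \<omega>) \<partial>M) * (\<integral>\<^sup>+ \<omega>. (?b \<omega>)\<^sup>2 \<partial>M) \<le> 1 * (\<integral>\<^sup>+ \<omega>. ennreal (V \<omega> / y + 1) \<partial>M)"
  proof (intro mult_mono canonical_pair_mixture[OF _ _ V canonical y] nn_integral_mono_AE eventually_mono[OF V])
    fix \<omega> assume v: "V \<omega> \<ge> 0"
    \<comment> \<open>This is \<open>sqrt t \<le> t\<close> for
      \<open>t = (V + y) / y \<ge> 1\<close>; it leaves a quantity linear in
      \<open>V\<close>.\<close>
    have "sqrt ((V \<omega> + y) / y) \<le> sqrt (((V \<omega> + y) / y)\<^sup>2)"
      using v y by (intro real_sqrt_le_mono) (simp add: power2_eq_square field_simps)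
    also have "\<dots> = V \<omega> / y + 1"
      using v y by (simp only: real_sqrt_abs) (simp add: field_simps)
    finally show "(?b \<omega>)\<^sup>2 \<le> ennreal (V \<omega> / y + 1)"
      using v y by (subst ennreal_power) (auto simp del: ennreal_plus intro!: ennreal_leI)
  qed auto
  also have "(\<integral>\<^sup>+ \<omega>. ennreal (V \<omega> / y + 1) \<partial>M) = ennreal (expectation (\<lambda>\<omega>. V \<omega> / y + 1))"
    using int V y by (intro nn_integral_eq_integral) (auto elim!: eventually_mono)
  \<comment> \<open>The choice of \<open>y\<close> as the mean of \<open>V\<close> gives 2, whose
    square root is the constant in the probability bound.\<close>
  also have "expectation (\<lambda>\<omega>. V \<omega> / y + 1) = 2"
    using int y by (simp add: prob_space y_def[symmetric])
  finally have sq: "(\<integral>\<^sup>+ \<omega>. ennreal (?u \<omega>) \<partial>M)\<^sup>2 \<le> (ennreal (sqrt 2))\<^sup>2"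
    by (simp add: ennreal_power)
  have "(\<integral>\<^sup>+ \<omega>. ennreal (?u \<omega>) \<partial>M) \<le> ennreal (sqrt 2)"
  proof (cases "\<integral>\<^sup>+ \<omega>. ennreal (?u \<omega>) \<partial>M" rule: ennreal_cases)
    case (real r)
    with sq have "ennreal (r\<^sup>2) \<le> ennreal 2" by (simp add: ennreal_power)
    then have "r\<^sup>2 \<le> 2" by (subst (asm) ennreal_le_iff) auto
    with real show ?thesis by (simp add: real_le_rsqrt)
  next
    case top
    with sq show ?thesis by (simp add: ennreal_power top_unique)
  qed
  then have "1 - sqrt 2 * exp (- x) \<le> prob {\<omega> \<in> space M. ?u \<omega> \<le> exp x}"
    by (intro prob_le_exp_ge) auto
  also have "\<dots> \<le> prob {\<omega> \<in> space M. \<bar>D \<omega>\<bar> \<le> 2 * sqrt ((V \<omega> + y) * x)}"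
  proof (rule finite_measure_mono_AE)
    show "AE \<omega> in M. \<omega> \<in> {\<omega> \<in> space M. ?u \<omega> \<le> exp x} \<longrightarrow>
      \<omega> \<in> {\<omega> \<in> space M. \<bar>D \<omega>\<bar> \<le> 2 * sqrt ((V \<omega> + y) * x)}"
      using V
    proof (rule eventually_mono, intro impI)
      fix \<omega> assume v: "V \<omega> \<ge> 0" and mem: "\<omega> \<in> {\<omega> \<in> space M. ?u \<omega> \<le> exp x}"
      then have "(D \<omega>)\<^sup>2 \<le> 4 * ((V \<omega> + y) * x)"
        using y by (simp add: field_simps)
      then have "\<bar>D \<omega>\<bar> \<le> sqrt (4 * ((V \<omega> + y) * x))"
        by (simp add: real_le_rsqrt)
      also have "\<dots> = 2 * sqrt ((V \<omega> + y) * x)" by (simp only: real_sqrt_mult real_sqrt_four)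
      finally show "\<omega> \<in> {\<omega> \<in> space M. \<bar>D \<omega>\<bar> \<le> 2 * sqrt ((V \<omega> + y) * x)}"
        using mem by simp
    qed
  qed measurable
  finally show ?thesis by (simp add: y_def)
qed


section \<open>Independent families and conditional expectations\<close>

lemma distr_indep_vars_reindex:
  assumes indep: "indep_vars N Y I" and "I \<noteq> {}" and h: "inj_on h K" "h \<in> K \<rightarrow> I"
  shows "distr M (\<Pi>\<^sub>M i\<in>K. N (h i)) (\<lambda>\<omega>. \<lambda>i\<in>K. Y (h i) \<omega>) = (\<Pi>\<^sub>M i\<in>K. distr M (N (h i)) (Y (h i)))"
proof -
  have rv: "Y i \<in> measurable M (N i)" if "i \<in> I" for i
    using indep that by (auto simp: indep_vars_def)
  let ?Q = "\<lambda>i. distr M (N i) (Y i)"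
  \<comment> \<open>The full family has a product law, and selecting its coordinates along the
    injection \<open>h\<close> gives a product law again. As \<open>h\<close> may change the index
    type, the same argument serves tuples picked out of the doubled sample and permutations of
    it.\<close>
  have distr: "distr M (PiM I N) (\<lambda>\<omega>. \<lambda>i\<in>I. Y i \<omega>) = PiM I ?Q"
    using indep_vars_iff_distr_eq_PiM'[OF \<open>I \<noteq> {}\<close> rv] indep by simp
  have tuple: "(\<lambda>\<omega>. \<lambda>i\<in>I. Y i \<omega>) \<in> measurable M (PiM I N)"
    by (intro measurable_restrict rv)
  have proj: "(\<lambda>z. \<lambda>i\<in>K. z (h i)) \<in> measurable (PiM I N) (\<Pi>\<^sub>M i\<in>K. N (h i))"
    using h by (intro measurable_restrict measurable_component_singleton) auto
  have "PiM K (\<lambda>i. ?Q (h i)) = distr (PiM I ?Q) (PiM K (\<lambda>i. ?Q (h i))) (\<lambda>z. \<lambda>i\<in>K. z (h i))"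
    using h rv by (intro distr_PiM_reindex[symmetric] prob_space_distr) auto
  also have "\<dots> = distr (PiM I ?Q) (PiM K (\<lambda>i. N (h i))) (\<lambda>z. \<lambda>i\<in>K. z (h i))"
    by (intro distr_cong sets_PiM_cong) auto
  also have "\<dots> = distr M (PiM K (\<lambda>i. N (h i))) ((\<lambda>z. \<lambda>i\<in>K. z (h i)) \<circ> (\<lambda>\<omega>. \<lambda>i\<in>I. Y i \<omega>))"
    unfolding distr[symmetric] by (rule distr_distr[OF proj tuple])
  also have "(\<lambda>z. \<lambda>i\<in>K. z (h i)) \<circ> (\<lambda>\<omega>. \<lambda>i\<in>I. Y i \<omega>) = (\<lambda>\<omega>. \<lambda>i\<in>K. Y (h i) \<omega>)"
    using h by (auto simp: fun_eq_iff restrict_def)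
  finally show ?thesis by (rule sym)
qed

lemma subalgebra_vimage_algebra:
  "T \<in> measurable M A \<Longrightarrow> subalgebra M (vimage_algebra (space M) T A)"
  by (auto simp: subalgebra_def sets_vimage_algebra2 measurable_space dest: measurable_sets)

text \<open>The freezing principle: given \<open>T\<close>, the independent \<open>U\<close> is
  integrated out with \<open>T\<close> held fixed. Since the joint law is a product, Fubini verifies
  the characterising identity on every event generated by \<open>T\<close>.\<close>

lemma real_cond_exp_indep_var:
  fixes g :: "'b \<times> 'b \<Rightarrow> real"
  assumes indep: "indep_var A T B U"
    and g[measurable]: "g \<in> borel_measurable (A \<Otimes>\<^sub>M B)"
    and int: "integrable M (\<lambda>\<omega>. g (T \<omega>, U \<omega>))"
  shows "AE \<omega> in M. real_cond_exp M (vimage_algebra (space M) T A) (\<lambda>\<omega>. g (T \<omega>, U \<omega>)) \<omega>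
           = (\<integral>u. g (T \<omega>, u) \<partial>distr M B U)"
proof -
  have [measurable]: "T \<in> measurable M A" "U \<in> measurable M B"
    and joint: "distr M A T \<Otimes>\<^sub>M distr M B U = distr M (A \<Otimes>\<^sub>M B) (\<lambda>\<omega>. (T \<omega>, U \<omega>))"
    using indep by (auto simp: indep_var_distribution_eq)
  let ?F = "vimage_algebra (space M) T A"
  let ?h = "\<lambda>t. \<integral>u. g (t, u) \<partial>distr M B U"
  interpret T: prob_space "distr M A T" by (rule prob_space_distr) simp
  interpret U: prob_space "distr M B U" by (rule prob_space_distr) simp
  interpret P: pair_sigma_finite "distr M A T" "distr M B U" ..
  interpret F: finite_measure_subalgebra M ?F
    by unfold_locales (rule subalgebra_vimage_algebra, simp)
  have h[measurable]: "?h \<in> borel_measurable A"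
    by measurable
  have int_g: "integrable (distr M A T \<Otimes>\<^sub>M distr M B U) g"
    unfolding joint using int by (subst integrable_distr_eq) auto
  have int_h: "integrable M (\<lambda>\<omega>. ?h (T \<omega>))"
    using P.integrable_fst'[OF int_g] by (subst (asm) integrable_distr_eq) auto
  show ?thesis
  proof (rule F.real_cond_exp_charact[OF _ int int_h])
    have "T \<in> measurable ?F A"
      by (rule measurable_vimage_algebra1) (auto dest: measurable_space[OF \<open>T \<in> measurable M A\<close>])
    then show "(\<lambda>\<omega>. ?h (T \<omega>)) \<in> borel_measurable ?F"
      by (rule measurable_compose) (rule h)
  next
    fix C assume "C \<in> sets ?F"
    then obtain C' where C: "C = T -` C' \<inter> space M" and [measurable]: "C' \<in> sets A"
      by (subst (asm) sets_vimage_algebra2) (auto dest: measurable_space[OF \<open>T \<in> measurable M A\<close>])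
    \<comment> \<open>The indicator of the conditioning event depends on \<open>t\<close> alone, so
      it can be put into the integrand and later pulled out of the inner integral.\<close>
    let ?g = "\<lambda>(t, u). indicator C' t * g (t, u)"
    have int_g': "integrable (distr M A T \<Otimes>\<^sub>M distr M B U) ?g"
    proof (rule Bochner_Integration.integrable_bound[OF int_g])
      show "AE p in distr M A T \<Otimes>\<^sub>M distr M B U. norm (?g p) \<le> norm (g p)"
        by (auto simp: indicator_def)
    qed measurable
    have "(LINT \<omega>:C|M. g (T \<omega>, U \<omega>)) = (\<integral>\<omega>. ?g (T \<omega>, U \<omega>) \<partial>M)"
      unfolding set_lebesgue_integral_def C
      by (intro Bochner_Integration.integral_cong) (auto simp: indicator_def)
    also have "\<dots> = (\<integral>p. ?g p \<partial>(distr M A T \<Otimes>\<^sub>M distr M B U))"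
      unfolding joint by (subst integral_distr) auto
    also have "\<dots> = (\<integral>t. (\<integral>u. ?g (t, u) \<partial>distr M B U) \<partial>distr M A T)"
      by (rule P.integral_fst'[OF int_g', symmetric])
    also have "\<dots> = (\<integral>t. indicator C' t * ?h t \<partial>distr M A T)"
      by simp
    also have "\<dots> = (\<integral>\<omega>. indicator C' (T \<omega>) * ?h (T \<omega>) \<partial>M)"
      by (subst integral_distr) auto
    also have "\<dots> = (LINT \<omega>:C|M. ?h (T \<omega>))"
      unfolding set_lebesgue_integral_def C
      by (intro Bochner_Integration.integral_cong) (auto simp: indicator_def)
    finally show "(LINT \<omega>:C|M. g (T \<omega>, U \<omega>)) = (LINT \<omega>:C|M. ?h (T \<omega>))" .
  qed
qed

end

text \<open>Brings the history into the form to which the freezing principle applies. The tuple is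
  measurable for the generated algebra because its coordinates are; conversely, each coordinate is a
  projection of the tuple. The bound \<open>i \<le> k\<close> becomes
  \<open>{..<Suc k}\<close>.\<close>

lemma hist_algebra_eq_vimage_algebra:
  assumes X: "\<And>i. i \<le> k \<Longrightarrow> X i \<in> measurable M (N i)"
  shows "hist_algebra M N X k
       = vimage_algebra (space M) (\<lambda>\<omega>. \<lambda>i\<in>{..<Suc k}. X i \<omega>) (PiM {..<Suc k} N)" (is "?H = ?V")
proof (rule measure_eqI)
  let ?G = "{X i -` A \<inter> space M | i A. i \<le> k \<and> A \<in> sets (N i)}"
  let ?T = "\<lambda>\<omega>. \<lambda>i\<in>{..<Suc k}. X i \<omega>"
  have sub: "?G \<subseteq> Pow (space M)" by auto
  have space: "space ?H = space M" and sets: "sets ?H = sigma_sets (space M) ?G"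
    by (simp_all add: hist_algebra_def sub)
  have T: "?T \<in> space M \<rightarrow> space (PiM {..<Suc k} N)"
    using measurable_space[OF X] by (auto simp: space_PiM)
  show "sets ?H = sets ?V"
  proof (intro antisym)
    have "X i \<in> measurable ?H (N i)" if "i \<le> k" for i
      using measurable_space[OF X[OF that]] that
      by (intro measurableI) (auto simp: space sets)
    then have T': "?T \<in> measurable ?H (PiM {..<Suc k} N)"
      by (intro measurable_restrict) auto
    show "sets ?V \<subseteq> sets ?H"
    proof
      fix C assume "C \<in> sets ?V"
      then obtain A where "A \<in> sets (PiM {..<Suc k} N)" "C = ?T -` A \<inter> space M"
        unfolding sets_vimage_algebra2[OF T] by blast
      with measurable_sets[OF T' this(1)] show "C \<in> sets ?H" by (simp only: space)
    qed
    have "X i -` A \<inter> space M \<in> sets ?V" if "i \<le> k" "A \<in> sets (N i)" for i A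
    proof -
      have "(\<lambda>\<omega>. ?T \<omega> i) \<in> measurable ?V (N i)"
        using measurable_compose[OF measurable_vimage_algebra1[OF T] measurable_component_singleton[of i]] that
        by (simp add: less_Suc_eq_le)
      from measurable_sets[OF this that(2)] that(1) show ?thesis
        by simp
    qed
    then have "sigma_sets (space ?V) ?G \<subseteq> sets ?V"
      by (intro sets.sigma_sets_subset) auto
    then show "sets ?H \<subseteq> sets ?V"
      by (simp add: sets)
  qed
\<comment> \<open>Equality of measures also concerns their values; both sides are built by
  \<open>sigma\<close> and carry the zero measure.\<close>
qed (simp add: hist_algebra_def vimage_algebra_def emeasure_sigma)

section \<open>The doubled sample: laws, independence and exchangeability\<close>

locale efron_stein_sample = prob_space M for M :: "'w measure" +
  fixes N :: "nat \<Rightarrow> 'a measure" and n :: nat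
    and X X' :: "nat \<Rightarrow> 'w \<Rightarrow> 'a" and f :: "(nat \<Rightarrow> 'a) \<Rightarrow> real"
  assumes n_pos: "n \<ge> 1"
    and X_rv: "\<And>i. i < n \<Longrightarrow> X i \<in> measurable M (N i)"
    and X'_rv: "\<And>i. i < n \<Longrightarrow> X' i \<in> measurable M (N i)"
    and indep: "indep_vars (\<lambda>j. case j of Inl i \<Rightarrow> N i | Inr i \<Rightarrow> N i)
           (\<lambda>j. case j of Inl i \<Rightarrow> X i | Inr i \<Rightarrow> X' i) (Inl ` {..<n} \<union> Inr ` {..<n})"
    and distr_X': "\<And>i. i < n \<Longrightarrow> distr M (N i) (X' i) = distr M (N i) (X i)"
    and f_measurable[measurable]: "f \<in> borel_measurable (PiM {..<n} N)"
    and f_square_integrable: "integrable M (\<lambda>\<omega>. (f (sample n X \<omega>))\<^sup>2)"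
begin

abbreviation "S \<equiv> sample n X"
abbreviation "S' \<equiv> sample_repl n X X'"
abbreviation "hist \<equiv> hist_algebra M N X"
abbreviation "I \<equiv> Inl ` {..<n} \<union> Inr ` {..<n}"
abbreviation "NN \<equiv> case_sum N N"
abbreviation "XX \<equiv> case_sum X X'"

definition past :: "nat \<Rightarrow> 'w \<Rightarrow> nat \<Rightarrow> 'a" where
  "past k \<omega> = (\<lambda>i\<in>{..<k}. X i \<omega>)"

definition tail :: "nat \<Rightarrow> 'w \<Rightarrow> nat \<Rightarrow> 'a" where
  "tail k \<omega> = (\<lambda>i\<in>{k..<n}. X i \<omega>)"

text \<open>This block starts at the replaced coordinate. It is independent of
  \<open>past (Suc k)\<close>, and together the two determine both \<open>S\<close> and
  \<open>S' k\<close>.\<close>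

definition tail_repl :: "nat \<Rightarrow> 'w \<Rightarrow> nat \<Rightarrow> 'a" where
  "tail_repl k \<omega> = (\<lambda>i\<in>{k..<n}. if i = k then X' i \<omega> else X i \<omega>)"

lemma S_measurable[measurable]: "S \<in> measurable M (PiM {..<n} N)"
  unfolding sample_def by (intro measurable_restrict X_rv) auto

lemma S'_measurable[measurable]: "S' k \<in> measurable M (PiM {..<n} N)"
proof -
  have "(\<lambda>\<omega>. if i = k then X' i \<omega> else X i \<omega>) \<in> measurable M (N i)" if "i < n" for i
    using X_rv[OF that] X'_rv[OF that] by (cases "i = k") auto
  then show ?thesis unfolding sample_repl_def by (intro measurable_restrict) auto
qed

lemma past_measurable[measurable]: "k \<le> n \<Longrightarrow> past k \<in> measurable M (PiM {..<k} N)"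
  unfolding past_def by (intro measurable_restrict X_rv) auto

lemma indep_sum: "indep_vars NN XX I"
  using indep by (simp add: case_sum_def cong: sum.case_cong)

lemma hist_eq: "k < n \<Longrightarrow> hist k = vimage_algebra (space M) (past (Suc k)) (PiM {..<Suc k} N)"
  unfolding past_def by (intro hist_algebra_eq_vimage_algebra X_rv) auto

lemma subalgebra_hist: "k < n \<Longrightarrow> finite_measure_subalgebra M (hist k)"
  unfolding hist_eq by unfold_locales (intro subalgebra_vimage_algebra past_measurable, simp)

lemma distr_tail: "distr M (PiM {k..<n} N) (tail k) = PiM {k..<n} (\<lambda>i. distr M (N i) (X i))"
  using distr_indep_vars_reindex[OF indep_sum, of Inl "{k..<n}"] n_pos
  by (auto simp: tail_def[abs_def] inj_on_def lessThan_empty_iff)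

text \<open>The fresh copy \<open>X' k\<close> has the law of \<open>X k\<close>, so replacing it
  leaves the product law unchanged. Hence integrating over this block gives the same function as
  integrating over \<open>tail k\<close>.\<close>

lemma distr_tail_repl:
  assumes "k < n"
  shows "distr M (PiM {k..<n} N) (tail_repl k) = PiM {k..<n} (\<lambda>i. distr M (N i) (X i))"
proof -
  let ?h = "\<lambda>i. if i = k then Inr i else Inl i"
  have "distr M (\<Pi>\<^sub>M i\<in>{k..<n}. NN (?h i)) (\<lambda>\<omega>. \<lambda>i\<in>{k..<n}. XX (?h i) \<omega>)
      = (\<Pi>\<^sub>M i\<in>{k..<n}. distr M (NN (?h i)) (XX (?h i)))"
    using n_pos by (intro distr_indep_vars_reindex[OF indep_sum]) (auto simp: inj_on_def lessThan_empty_iff)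
  also have "(\<Pi>\<^sub>M i\<in>{k..<n}. NN (?h i)) = PiM {k..<n} N" by (intro PiM_cong) auto
  also have "(\<lambda>\<omega>. \<lambda>i\<in>{k..<n}. XX (?h i) \<omega>) = tail_repl k"
    by (auto simp: tail_repl_def fun_eq_iff)
  also have "(\<Pi>\<^sub>M i\<in>{k..<n}. distr M (NN (?h i)) (XX (?h i))) = PiM {k..<n} (\<lambda>i. distr M (N i) (X i))"
    by (intro PiM_cong) (auto simp: distr_X')
  finally show ?thesis .
qed

text \<open>The two tuples read off disjoint blocks of the doubled index set: \<open>?A\<close>
  holds the original labels up to \<open>k\<close>, \<open>?B\<close> the fresh label
  \<open>Inr k\<close> and the later original ones.\<close>

lemma indep_past_tail_repl:
  assumes "k < n"
  shows "indep_var (PiM {..<Suc k} N) (past (Suc k)) (PiM {k..<n} N) (tail_repl k)"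
proof -
  let ?A = "Inl ` {..<Suc k}" and ?B = "insert (Inr k) (Inl ` {Suc k..<n})"
  let ?p = "\<lambda>z. \<lambda>i\<in>{..<Suc k}. z (Inl i)"
  let ?q = "\<lambda>z. \<lambda>i\<in>{k..<n}. z (if i = k then Inr i else Inl i)"
  have "indep_var (PiM ?A NN) (\<lambda>\<omega>. \<lambda>i\<in>?A. XX i \<omega>) (PiM ?B NN) (\<lambda>\<omega>. \<lambda>i\<in>?B. XX i \<omega>)"
    using assms by (intro indep_var_restrict[OF indep_sum]) auto
  moreover have "?p \<in> measurable (PiM ?A NN) (PiM {..<Suc k} N)"
  proof (rule measurable_restrict)
    fix i assume "i \<in> {..<Suc k}"
    then show "(\<lambda>z. z (Inl i)) \<in> measurable (PiM ?A NN) (N i)"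
      using measurable_component_singleton[of "Inl i" ?A NN] by auto
  qed
  moreover have "?q \<in> measurable (PiM ?B NN) (PiM {k..<n} N)"
  proof (rule measurable_restrict)
    fix i assume "i \<in> {k..<n}"
    then show "(\<lambda>z. z (if i = k then Inr i else Inl i)) \<in> measurable (PiM ?B NN) (N i)"
      using measurable_component_singleton[of "Inl i" ?B NN] measurable_component_singleton[of "Inr i" ?B NN]
      by auto
  qed
  ultimately have "indep_var (PiM {..<Suc k} N) (?p \<circ> (\<lambda>\<omega>. \<lambda>i\<in>?A. XX i \<omega>))
      (PiM {k..<n} N) (?q \<circ> (\<lambda>\<omega>. \<lambda>i\<in>?B. XX i \<omega>))"
    by (rule indep_var_compose)
  moreover have "?p \<circ> (\<lambda>\<omega>. \<lambda>i\<in>?A. XX i \<omega>) = past (Suc k)"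
    by (auto simp: past_def fun_eq_iff)
  moreover have "?q \<circ> (\<lambda>\<omega>. \<lambda>i\<in>?B. XX i \<omega>) = tail_repl k"
    by (auto simp: tail_repl_def fun_eq_iff)
  ultimately show ?thesis by (simp only:)
qed

text \<open>Follows from the previous independence by forgetting coordinate \<open>k\<close> of the
  second tuple.\<close>

lemma indep_past_tail:
  assumes "k < n"
  shows "indep_var (PiM {..<Suc k} N) (past (Suc k)) (PiM {Suc k..<n} N) (tail (Suc k))"
proof -
  have "indep_var (PiM {..<Suc k} N) ((\<lambda>t. t) \<circ> past (Suc k))
      (PiM {Suc k..<n} N) ((\<lambda>u. restrict u {Suc k..<n}) \<circ> tail_repl k)"
    by (rule indep_var_compose[OF indep_past_tail_repl[OF assms]])
       (auto intro!: measurable_restrict_subset)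
  moreover have "(\<lambda>u. restrict u {Suc k..<n}) \<circ> tail_repl k = tail (Suc k)"
    by (auto simp: tail_repl_def tail_def fun_eq_iff)
  ultimately show ?thesis by (simp add: comp_def)
qed

text \<open>Exchanging \<open>X k\<close> and \<open>X' k\<close> preserves the joint law, fixes the past and swaps the two samples.\<close>

lemma distr_swap:
  assumes "k < n"
  defines "R \<equiv> PiM {..<k} N \<Otimes>\<^sub>M PiM {..<n} N \<Otimes>\<^sub>M PiM {..<n} N"
  shows "distr M R (\<lambda>\<omega>. (past k \<omega>, S \<omega>, S' k \<omega>)) = distr M R (\<lambda>\<omega>. (past k \<omega>, S' k \<omega>, S \<omega>))"
proof -
  \<comment> \<open>The exchange is a transposition of labels in the doubled index set.
    \<open>?G\<close> reads the triple off the doubled sample, so composing it with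
    \<open>?Z\<close> or \<open>?Z'\<close> gives the two triples to be compared.\<close>
  let ?sw = "Transposition.transpose (Inl k) (Inr k) :: nat + nat \<Rightarrow> nat + nat"
  let ?Z = "\<lambda>\<omega>. \<lambda>j\<in>I. XX j \<omega>" and ?Z' = "\<lambda>\<omega>. \<lambda>j\<in>I. XX (?sw j) \<omega>"
  let ?G = "\<lambda>z. (\<lambda>i\<in>{..<k}. z (Inl i), \<lambda>i\<in>{..<n}. z (Inl i),
                 \<lambda>i\<in>{..<n}. z (if i = k then Inr i else Inl i))"
  have sw: "inj_on ?sw I" "?sw \<in> I \<rightarrow> I"
    using assms by (auto simp: Transposition.transpose_def inj_on_def)
  have NN_sw: "NN (?sw j) = NN j" for j
    by (simp add: Transposition.transpose_def)
  have Ine: "I \<noteq> {}" using assms by auto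
  have rv: "XX j \<in> measurable M (NN j)" if "j \<in> I" for j
    using that X_rv X'_rv by auto
  have Z: "?Z \<in> measurable M (PiM I NN)"
    by (intro measurable_restrict rv)
  have Z': "?Z' \<in> measurable M (PiM I NN)"
  proof (rule measurable_restrict)
    fix j assume "j \<in> I"
    with sw(2) have "?sw j \<in> I" by (rule funcset_mem)
    from rv[OF this] show "XX (?sw j) \<in> measurable M (NN j)" by (simp only: NN_sw)
  qed
  have "distr M (PiM I NN) ?Z' = PiM I (\<lambda>j. distr M (NN j) (XX (?sw j)))"
    using distr_indep_vars_reindex[OF indep_sum Ine sw] by (simp only: NN_sw)
  also have "\<dots> = PiM I (\<lambda>j. distr M (NN j) (XX j))"
    using assms by (intro PiM_cong) (auto simp: Transposition.transpose_def distr_X')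
  also have "\<dots> = distr M (PiM I NN) ?Z"
    using distr_indep_vars_reindex[OF indep_sum Ine, of "\<lambda>j. j" I] by simp
  finally have eq: "distr M (PiM I NN) ?Z' = distr M (PiM I NN) ?Z" .
  have comp: "(\<lambda>z. z j) \<in> measurable (PiM I NN) (NN j)" if "j \<in> I" for j
    using that by (rule measurable_component_singleton)
  have G: "?G \<in> measurable (PiM I NN) R"
    unfolding R_def
  proof (intro measurable_Pair measurable_restrict)
    fix i assume "i \<in> {..<k}"
    then show "(\<lambda>z. z (Inl i)) \<in> measurable (PiM I NN) (N i)"
      using comp[of "Inl i"] assms by auto
  next
    fix i assume "i \<in> {..<n}"
    then show "(\<lambda>z. z (Inl i)) \<in> measurable (PiM I NN) (N i)"
      and "(\<lambda>z. z (if i = k then Inr i else Inl i)) \<in> measurable (PiM I NN) (N i)"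
      using comp[of "Inl i"] comp[of "Inr i"] by auto
  qed
  have "distr M R (?G \<circ> ?Z) = distr M R (?G \<circ> ?Z')"
    using eq by (simp only: distr_distr[OF G Z, symmetric] distr_distr[OF G Z', symmetric])
  moreover have "?G \<circ> ?Z = (\<lambda>\<omega>. (past k \<omega>, S \<omega>, S' k \<omega>))"
    using assms by (auto simp: past_def sample_def sample_repl_def fun_eq_iff)
  moreover have "?G \<circ> ?Z' = (\<lambda>\<omega>. (past k \<omega>, S' k \<omega>, S \<omega>))"
    using assms by (auto simp: past_def sample_def sample_repl_def fun_eq_iff Transposition.transpose_def)
  ultimately show ?thesis by (simp only:)
qed

text \<open>Exchangeability transfers the second moment from \<open>S\<close> to
  \<open>S' k\<close>.\<close>

lemma square_integrable_S':
  assumes "k < n"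
  shows "integrable M (\<lambda>\<omega>. (f (S' k \<omega>))\<^sup>2)"
proof -
  let ?R = "PiM {..<k} N \<Otimes>\<^sub>M PiM {..<n} N \<Otimes>\<^sub>M PiM {..<n} N"
  have [measurable]: "past k \<in> measurable M (PiM {..<k} N)"
    using assms by (intro past_measurable) simp
  have "integrable (distr M ?R (\<lambda>\<omega>. (past k \<omega>, S \<omega>, S' k \<omega>))) (\<lambda>(t, s, s'). (f s)\<^sup>2)"
    using f_square_integrable by (subst integrable_distr_eq) auto
  then show ?thesis
    unfolding distr_swap[OF assms] by (subst (asm) integrable_distr_eq) auto
qed

lemma integrable_S: "integrable M (\<lambda>\<omega>. f (S \<omega>))"
  using f_square_integrable by (rule square_integrable_imp_integrable[rotated]) measurable

lemma integrable_S': "k < n \<Longrightarrow> integrable M (\<lambda>\<omega>. f (S' k \<omega>))"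
  using square_integrable_S' by (rule square_integrable_imp_integrable[rotated]) measurable

lemma square_integrable_diff:
  assumes "k < n"
  shows "integrable M (\<lambda>\<omega>. (f (S \<omega>) - f (S' k \<omega>))\<^sup>2)"
proof (rule Bochner_Integration.integrable_bound)
  show "integrable M (\<lambda>\<omega>. 2 * (f (S \<omega>))\<^sup>2 + 2 * (f (S' k \<omega>))\<^sup>2)"
    using f_square_integrable square_integrable_S'[OF assms] by auto
  have "(a - b)\<^sup>2 \<le> 2 * a\<^sup>2 + 2 * b\<^sup>2" for a b :: real
    using zero_le_power2[of "a + b"] by (simp add: power2_eq_square algebra_simps)
  then show "AE \<omega> in M. norm ((f (S \<omega>) - f (S' k \<omega>))\<^sup>2) \<le> norm (2 * (f (S \<omega>))\<^sup>2 + 2 * (f (S' k \<omega>))\<^sup>2)"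
    by auto
qed measurable

section \<open>The Doob martingale of the sample function\<close>

definition doob :: "nat \<Rightarrow> (nat \<Rightarrow> 'a) \<Rightarrow> real" where
  "doob k t = (\<integral>u. f (merge {..<k} {k..<n} (t, u)) \<partial>PiM {k..<n} (\<lambda>i. distr M (N i) (X i)))"

text \<open>The left tuple may carry more coordinates than \<open>merge\<close> reads. This allows
  \<open>m = Suc k\<close> below, where one conditions on \<open>past (Suc k)\<close> but coordinate
  \<open>k\<close> is taken from the other tuple.\<close>

lemma f_merge_measurable:
  assumes "k \<le> n" "k \<le> m"
  shows "(\<lambda>p. f (merge {..<k} {k..<n} p)) \<in> borel_measurable (PiM {..<m} N \<Otimes>\<^sub>M PiM {k..<n} N)"
proof -
  have Un: "{..<k} \<union> {k..<n} = {..<n}" using assms by auto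
  have "(\<lambda>t. restrict t {..<k}) \<in> measurable (PiM {..<m} N) (PiM {..<k} N)"
    using assms by (intro measurable_restrict_subset) auto
  then have "(\<lambda>p. (restrict (fst p) {..<k}, snd p)) \<in>
      measurable (PiM {..<m} N \<Otimes>\<^sub>M PiM {k..<n} N) (PiM {..<k} N \<Otimes>\<^sub>M PiM {k..<n} N)"
    by measurable
  moreover have "(\<lambda>p. f (merge {..<k} {k..<n} p)) \<in> borel_measurable (PiM {..<k} N \<Otimes>\<^sub>M PiM {k..<n} N)"
    using measurable_merge[of "{..<k}" "{k..<n}" N] unfolding Un by measurable
  ultimately have "(\<lambda>p. f (merge {..<k} {k..<n} (restrict (fst p) {..<k}, snd p)))
      \<in> borel_measurable (PiM {..<m} N \<Otimes>\<^sub>M PiM {k..<n} N)"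
    by (rule measurable_compose)
  then show ?thesis by simp
qed

lemma cond_exp_S:
  assumes "k < n"
  shows "AE \<omega> in M. real_cond_exp M (hist k) (\<lambda>\<omega>. f (S \<omega>)) \<omega> = doob (Suc k) (past (Suc k) \<omega>)"
proof -
  have merge: "merge {..<Suc k} {Suc k..<n} (past (Suc k) \<omega>, tail (Suc k) \<omega>) = S \<omega>" for \<omega>
    using assms by (auto simp: merge_def past_def tail_def sample_def fun_eq_iff)
  show ?thesis
    using real_cond_exp_indep_var[OF indep_past_tail[OF assms] f_merge_measurable] integrable_S assms
    unfolding merge hist_eq[OF assms] distr_tail doob_def by simp
qed

text \<open>Since \<open>X' k\<close> is not part of the history, it is integrated out together with the later coordinates.\<close>

lemma cond_exp_S':
  assumes "k < n"
  shows "AE \<omega> in M. real_cond_exp M (hist k) (\<lambda>\<omega>. f (S' k \<omega>)) \<omega> = doob k (past k \<omega>)"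
proof -
  have merge: "merge {..<k} {k..<n} (past k \<omega>, tail_repl k \<omega>) = S' k \<omega>" for \<omega>
    using assms by (intro ext) (simp add: merge_def past_def tail_repl_def sample_repl_def)
  \<comment> \<open>Coordinate \<open>k\<close> of the history is ignored here, so the conditional
    mean depends only on \<open>past k\<close>.\<close>
  have past: "merge {..<k} {k..<n} (past (Suc k) \<omega>, u) = merge {..<k} {k..<n} (past k \<omega>, u)" for \<omega> u
    by (auto simp: merge_def past_def fun_eq_iff)
  show ?thesis
    using real_cond_exp_indep_var[OF indep_past_tail_repl[OF assms] f_merge_measurable] integrable_S' assms
    unfolding past merge hist_eq[OF assms] distr_tail_repl[OF assms] doob_def by simp
qed

lemma doob_0: "doob 0 (past 0 \<omega>) = expectation (\<lambda>\<omega>. f (S \<omega>))"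
proof -
  have S: "S = tail 0" by (auto simp: tail_def sample_def fun_eq_iff)
  have "doob 0 (past 0 \<omega>) = (\<integral>u. f (merge {} {0..<n} (past 0 \<omega>, u)) \<partial>distr M (PiM {0..<n} N) (tail 0))"
    by (simp add: doob_def distr_tail)
  also have "\<dots> = (\<integral>\<eta>. f (merge {} {0..<n} (past 0 \<omega>, tail 0 \<eta>)) \<partial>M)"
  proof (rule integral_distr)
    show "tail 0 \<in> measurable M (PiM {0..<n} N)"
      using S_measurable by (simp add: S atLeast0LessThan)
    have "(\<lambda>u. f (merge {} {0..<n} (past 0 \<omega>, u))) = (\<lambda>u. f (restrict u {..<n}))"
      by (auto simp: merge_def restrict_def)
    moreover have "(\<lambda>u. f (restrict u {..<n})) \<in> borel_measurable (PiM {0..<n} N)"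
      by (rule measurable_compose[OF measurable_restrict_subset f_measurable]) auto
    ultimately show "(\<lambda>u. f (merge {} {0..<n} (past 0 \<omega>, u))) \<in> borel_measurable (PiM {0..<n} N)"
      by (simp only:)
  qed
  also have "\<dots> = expectation (\<lambda>\<omega>. f (S \<omega>))"
    by (intro Bochner_Integration.integral_cong refl arg_cong[where f=f])
       (auto simp: merge_def tail_def sample_def fun_eq_iff)
  finally show ?thesis .
qed

lemma doob_n: "doob n (past n \<omega>) = f (S \<omega>)"
proof -
  interpret P: prob_space "PiM {n..<n} (\<lambda>i. distr M (N i) (X i))"
    by (intro prob_space_PiM) auto
  have "merge {..<n} {n..<n} (past n \<omega>, u) = S \<omega>" for u
    by (auto simp: merge_def past_def sample_def fun_eq_iff)
  then show ?thesis using P.prob_space by (simp add: doob_def)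
qed

text \<open>Each summand is the increment from \<open>doob k\<close> to \<open>doob (Suc k)\<close>,
  so the sum telescopes between the constant mean at 0 and \<open>f S\<close> at
  \<open>n\<close>.\<close>

lemma martingale_decomposition:
  "AE \<omega> in M. (\<Sum>k<n. real_cond_exp M (hist k) (\<lambda>\<omega>. f (S \<omega>) - f (S' k \<omega>)) \<omega>)
     = f (S \<omega>) - expectation (\<lambda>\<omega>. f (S \<omega>))"
proof -
  have "AE \<omega> in M. real_cond_exp M (hist k) (\<lambda>\<omega>. f (S \<omega>) - f (S' k \<omega>)) \<omega>
      = doob (Suc k) (past (Suc k) \<omega>) - doob k (past k \<omega>)" if "k < n" for k
  proof -
    interpret F: finite_measure_subalgebra M "hist k" by (rule subalgebra_hist[OF that])
    show ?thesis
      using F.real_cond_exp_diff[OF integrable_S integrable_S'[OF that]] cond_exp_S[OF that] cond_exp_S'[OF that]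
      by eventually_elim simp
  qed
  then have "AE \<omega> in M. \<forall>k\<in>{..<n}. real_cond_exp M (hist k) (\<lambda>\<omega>. f (S \<omega>) - f (S' k \<omega>)) \<omega>
      = doob (Suc k) (past (Suc k) \<omega>) - doob k (past k \<omega>)"
    by (intro AE_finite_allI) auto
  then show ?thesis
  proof eventually_elim
    case (elim \<omega>)
    then have "(\<Sum>k<n. real_cond_exp M (hist k) (\<lambda>\<omega>. f (S \<omega>) - f (S' k \<omega>)) \<omega>)
        = (\<Sum>k<n. doob (Suc k) (past (Suc k) \<omega>) - doob k (past k \<omega>))"
      by (intro sum.cong) auto
    also have "\<dots> = doob n (past n \<omega>) - doob 0 (past 0 \<omega>)"
      by (rule sum_lessThan_telescope)
    finally show ?case by (simp add: doob_n doob_0)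
  qed
qed

text \<open>Provides a version of the conditional expectation that is an explicit measurable
  function of the coordinates. The exchange argument needs this form, since it speaks about the law
  of the tuple \<open>past k\<close>.\<close>

lemma cond_exp_factors_through_past:
  fixes F :: "(nat \<Rightarrow> 'a) \<times> (nat \<Rightarrow> 'a) \<Rightarrow> real"
  assumes "k < n" and F[measurable]: "F \<in> borel_measurable (PiM {..<n} N \<Otimes>\<^sub>M PiM {..<n} N)"
    and int: "integrable M (\<lambda>\<omega>. F (S \<omega>, S' k \<omega>))"
  obtains a where "a \<in> borel_measurable (PiM {..<Suc k} N)"
    "AE \<omega> in M. real_cond_exp M (hist k) (\<lambda>\<omega>. F (S \<omega>, S' k \<omega>)) \<omega> = a (past (Suc k) \<omega>)"
proof -
  let ?P = "PiM {..<Suc k} N \<Otimes>\<^sub>M PiM {k..<n} N"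
  let ?s = "\<lambda>p. merge {..<Suc k} {k..<n} p"
  let ?s' = "\<lambda>p. merge {..<k} {k..<n} (restrict (fst p) {..<k}, snd p)"
  have Un: "{..<Suc k} \<union> {k..<n} = {..<n}" "{..<k} \<union> {k..<n} = {..<n}" using assms by auto
  have [measurable]: "?s \<in> measurable ?P (PiM {..<n} N)"
    using measurable_merge[of "{..<Suc k}" "{k..<n}" N] unfolding Un .
  have [measurable]: "merge {..<k} {k..<n} \<in> measurable (PiM {..<k} N \<Otimes>\<^sub>M PiM {k..<n} N) (PiM {..<n} N)"
    using measurable_merge[of "{..<k}" "{k..<n}" N] unfolding Un .
  have [measurable]: "(\<lambda>t. restrict t {..<k}) \<in> measurable (PiM {..<Suc k} N) (PiM {..<k} N)"
    by (intro measurable_restrict_subset) auto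
  have g: "(\<lambda>p. F (?s p, ?s' p)) \<in> borel_measurable ?P"
    by measurable
  \<comment> \<open>On overlapping indices \<open>merge\<close> prefers its left argument. Hence
    \<open>?s\<close> takes \<open>X k\<close> from the history, while the restriction in
    \<open>?s'\<close> makes room for \<open>X' k\<close>.\<close>
  have eq: "?s (past (Suc k) \<omega>, tail_repl k \<omega>) = S \<omega>"
      "?s' (past (Suc k) \<omega>, tail_repl k \<omega>) = S' k \<omega>" for \<omega>
    using assms by (auto simp: merge_def past_def tail_repl_def sample_def sample_repl_def fun_eq_iff)
  interpret U: prob_space "distr M (PiM {k..<n} N) (tail_repl k)"
    using indep_past_tail_repl[OF assms(1)] by (intro prob_space_distr) (rule indep_var_rv2)
  have a: "(\<lambda>t. \<integral>u. F (?s (t, u), ?s' (t, u)) \<partial>distr M (PiM {k..<n} N) (tail_repl k))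
      \<in> borel_measurable (PiM {..<Suc k} N)"
    using g by (intro U.borel_measurable_lebesgue_integral) (simp add: case_prod_beta')
  show ?thesis
    using real_cond_exp_indep_var[OF indep_past_tail_repl[OF assms(1)] g] int
    unfolding eq by (intro that[OF a]) (simp add: hist_eq[OF assms(1)])
qed


section \<open>Symmetrization and the exponential supermartingale\<close>

lemma integral_exp_symmetrized_le:
  assumes "k < n" and w[measurable]: "w \<in> borel_measurable (PiM {..<k} N)"
    and int: "integrable M (\<lambda>\<omega>. exp (w (past k \<omega>)))"
  defines "E \<equiv> \<lambda>l \<omega>. exp (l * (f (S \<omega>) - f (S' k \<omega>)) - l\<^sup>2 * (f (S \<omega>) - f (S' k \<omega>))\<^sup>2 / 2)"
  shows "integrable M (\<lambda>\<omega>. exp (w (past k \<omega>)) * E l \<omega>)"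
    and "(\<integral>\<omega>. exp (w (past k \<omega>)) * E l \<omega> \<partial>M) \<le> (\<integral>\<omega>. exp (w (past k \<omega>)) \<partial>M)"
proof -
  let ?R = "PiM {..<k} N \<Otimes>\<^sub>M PiM {..<n} N \<Otimes>\<^sub>M PiM {..<n} N"
  let ?c = "\<lambda>l (t, s, s'). exp (w t) * exp (l * (f s - f s') - l\<^sup>2 * (f s - f s')\<^sup>2 / 2)"
  have [measurable]: "past k \<in> measurable M (PiM {..<k} N)"
    using assms by (intro past_measurable) simp
  \<comment> \<open>Proved for all \<open>l\<close>, since the symmetrization also uses
    \<open>- l\<close>.\<close>
  show int_E: "integrable M (\<lambda>\<omega>. exp (w (past k \<omega>)) * E l \<omega>)" for l
  proof (rule Bochner_Integration.integrable_bound)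
    show "integrable M (\<lambda>\<omega>. exp (w (past k \<omega>)) * exp (1 / 2))"
      using int by simp
    show "AE \<omega> in M. norm (exp (w (past k \<omega>)) * E l \<omega>) \<le> norm (exp (w (past k \<omega>)) * exp (1 / 2))"
      unfolding E_def using exp_quadratic_le by (intro AE_I2) (simp add: abs_mult)
  qed (unfold E_def, measurable)
  \<comment> \<open>Exchanging \<open>S\<close> and \<open>S' k\<close> keeps the weight, a function
    of \<open>past k\<close>, and flips the sign of the difference. So \<open>l\<close> and
    \<open>- l\<close> give the same integral, and their average produces a
    \<open>cosh\<close>.\<close>
  have "(\<integral>\<omega>. exp (w (past k \<omega>)) * E l \<omega> \<partial>M) = (\<integral>p. ?c l p \<partial>distr M ?R (\<lambda>\<omega>. (past k \<omega>, S \<omega>, S' k \<omega>)))"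
    unfolding E_def by (subst integral_distr) auto
  also have "\<dots> = (\<integral>\<omega>. exp (w (past k \<omega>)) * E (- l) \<omega> \<partial>M)"
    unfolding distr_swap[OF assms(1)] E_def
    by (subst integral_distr) (auto simp: algebra_simps power2_commute)
  finally have "2 * (\<integral>\<omega>. exp (w (past k \<omega>)) * E l \<omega> \<partial>M)
      = (\<integral>\<omega>. exp (w (past k \<omega>)) * E l \<omega> \<partial>M) + (\<integral>\<omega>. exp (w (past k \<omega>)) * E (- l) \<omega> \<partial>M)"
    by simp
  also have "\<dots> = (\<integral>\<omega>. exp (w (past k \<omega>)) * E l \<omega> + exp (w (past k \<omega>)) * E (- l) \<omega> \<partial>M)"
    by (intro Bochner_Integration.integral_add[symmetric] int_E)
  also have "\<dots> \<le> (\<integral>\<omega>. 2 * exp (w (past k \<omega>)) \<partial>M)"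
  proof (rule integral_mono)
    fix \<omega>
    let ?z = "l * (f (S \<omega>) - f (S' k \<omega>))"
    have "E l \<omega> = exp (?z + - (?z\<^sup>2 / 2))" "E (- l) \<omega> = exp (- ?z + - (?z\<^sup>2 / 2))"
      by (simp_all add: E_def power_mult_distrib)
    then have "E l \<omega> + E (- l) \<omega> = 2 * (cosh ?z * exp (- (?z\<^sup>2 / 2)))"
      by (simp only: exp_add cosh_field_def) (simp add: field_simps)
    \<comment> \<open>The quadratic compensator cancels the bound on \<open>cosh\<close>
      exactly.\<close>
    also have "\<dots> \<le> 2 * (exp (?z\<^sup>2 / 2) * exp (- (?z\<^sup>2 / 2)))"
      by (intro mult_left_mono mult_right_mono cosh_le_exp_half_square) auto
    finally have "E l \<omega> + E (- l) \<omega> \<le> 2"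
      by (simp flip: exp_add)
    then show "exp (w (past k \<omega>)) * E l \<omega> + exp (w (past k \<omega>)) * E (- l) \<omega> \<le> 2 * exp (w (past k \<omega>))"
      by (simp flip: distrib_left)
  qed (use int int_E in auto)
  finally show "(\<integral>\<omega>. exp (w (past k \<omega>)) * E l \<omega> \<partial>M) \<le> (\<integral>\<omega>. exp (w (past k \<omega>)) \<partial>M)"
    by simp
qed

text \<open>Induction on \<open>k\<close>, adding one increment at a time. The exponent is carried
  as a function \<open>w\<close> of \<open>past k\<close>, equal to the partial sum only almost
  everywhere, so that \<open>exp w\<close> can serve as the weight in the symmetrization bound at
  the next step.\<close>

lemma exp_supermartingale:
  fixes l :: real
  assumes "k \<le> n"
  defines "Z \<equiv> \<lambda>j \<omega>. l * real_cond_exp M (hist j) (\<lambda>\<eta>. f (S \<eta>) - f (S' j \<eta>)) \<omega>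
    - l\<^sup>2 / 2 * real_cond_exp M (hist j) (\<lambda>\<eta>. (f (S \<eta>) - f (S' j \<eta>))\<^sup>2) \<omega>"
  shows "\<exists>w\<in>borel_measurable (PiM {..<k} N). integrable M (\<lambda>\<omega>. exp (w (past k \<omega>)))
    \<and> (\<integral>\<omega>. exp (w (past k \<omega>)) \<partial>M) \<le> 1 \<and> (AE \<omega> in M. w (past k \<omega>) = (\<Sum>j<k. Z j \<omega>))"
  using assms(1)
proof (induction k)
  case 0
  show ?case by (intro bexI[of _ "\<lambda>_. 0"]) (auto simp: prob_space)
next
  case (Suc k)
  then have k: "k < n" by simp
  interpret H: finite_measure_subalgebra M "hist k" by (rule subalgebra_hist[OF k])
  from Suc obtain w where w[measurable]: "w \<in> borel_measurable (PiM {..<k} N)"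
    and int_w: "integrable M (\<lambda>\<omega>. exp (w (past k \<omega>)))"
    and le_w: "(\<integral>\<omega>. exp (w (past k \<omega>)) \<partial>M) \<le> 1"
    and w_eq: "AE \<omega> in M. w (past k \<omega>) = (\<Sum>j<k. Z j \<omega>)"
    by auto
  have past_k[measurable]: "past k \<in> measurable M (PiM {..<k} N)"
    and past_Suc[measurable]: "past (Suc k) \<in> measurable M (PiM {..<Suc k} N)"
    using k by (auto intro: past_measurable)
  let ?Y = "\<lambda>\<omega>. f (S \<omega>) - f (S' k \<omega>)"
  let ?q = "\<lambda>\<omega>. l * ?Y \<omega> - l\<^sup>2 * (?Y \<omega>)\<^sup>2 / 2"
  have int_Y: "integrable M ?Y" "integrable M (\<lambda>\<omega>. (?Y \<omega>)\<^sup>2)"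
    using integrable_S integrable_S'[OF k] square_integrable_diff[OF k] by auto
  then have int_q: "integrable M ?q" by auto
  have int_exp_q: "integrable M (\<lambda>\<omega>. exp (?q \<omega>))"
    using exp_quadratic_le by (intro integrable_const_bound[of _ "exp (1 / 2)"]) auto
  let ?F = "\<lambda>(s, s'). l * (f s - f s') - l\<^sup>2 * (f s - f s')\<^sup>2 / 2"
  have F: "?F \<in> borel_measurable (PiM {..<n} N \<Otimes>\<^sub>M PiM {..<n} N)"
    by measurable
  have int_F: "integrable M (\<lambda>\<omega>. ?F (S \<omega>, S' k \<omega>))"
    using int_q by simp
  obtain a where a[measurable]: "a \<in> borel_measurable (PiM {..<Suc k} N)"
    and "AE \<omega> in M. real_cond_exp M (hist k) (\<lambda>\<omega>. ?F (S \<omega>, S' k \<omega>)) \<omega> = a (past (Suc k) \<omega>)"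
    by (rule cond_exp_factors_through_past[OF k F int_F])
  then have a_eq: "AE \<omega> in M. real_cond_exp M (hist k) ?q \<omega> = a (past (Suc k) \<omega>)"
    by simp
  \<comment> \<open>By linearity \<open>Z k\<close> is the conditional expectation of the single
    variable \<open>?q\<close>, which prepares for Jensen's inequality.\<close>
  have "AE \<omega> in M. real_cond_exp M (hist k) (\<lambda>\<omega>. l * ?Y \<omega> - l\<^sup>2 / 2 * (?Y \<omega>)\<^sup>2) \<omega>
      = real_cond_exp M (hist k) (\<lambda>\<omega>. l * ?Y \<omega>) \<omega> - real_cond_exp M (hist k) (\<lambda>\<omega>. l\<^sup>2 / 2 * (?Y \<omega>)\<^sup>2) \<omega>"
    by (intro H.real_cond_exp_diff integrable_mult_right int_Y)
  with H.real_cond_exp_cmult[OF int_Y(1), of l] H.real_cond_exp_cmult[OF int_Y(2), of "l\<^sup>2 / 2"]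
  have "AE \<omega> in M. real_cond_exp M (hist k) ?q \<omega> = Z k \<omega>"
    unfolding Z_def by eventually_elim simp
  with a_eq have a_Z: "AE \<omega> in M. a (past (Suc k) \<omega>) = Z k \<omega>"
    by eventually_elim simp
  have jensen: "AE \<omega> in M. exp (real_cond_exp M (hist k) ?q \<omega>)
      \<le> real_cond_exp M (hist k) (\<lambda>\<omega>. exp (?q \<omega>)) \<omega>"
    using convex_on_exp[of 1] int_q int_exp_q
    by (intro H.real_cond_exp_jensens_inequality(2)[where I = UNIV]) auto
  \<comment> \<open>The new exponent adds the version \<open>a\<close> of the \<open>k\<close>-th
    increment to the old one, which reads only coordinates below \<open>k\<close>.\<close>
  define w' where "w' t = w (restrict t {..<k}) + a t" for t
  have restrict[measurable]: "(\<lambda>t. restrict t {..<k}) \<in> measurable (PiM {..<Suc k} N) (PiM {..<k} N)"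
    by (intro measurable_restrict_subset) auto
  have w'[measurable]: "w' \<in> borel_measurable (PiM {..<Suc k} N)"
    unfolding w'_def by measurable
  have past_restrict: "restrict (past (Suc k) \<omega>) {..<k} = past k \<omega>" for \<omega>
    by (auto simp: past_def fun_eq_iff)
  have past_hist: "past (Suc k) \<in> measurable (hist k) (PiM {..<Suc k} N)"
    unfolding hist_eq[OF k] using measurable_space[OF past_Suc]
    by (intro measurable_vimage_algebra1) auto
  have w_hist: "(\<lambda>\<omega>. exp (w (past k \<omega>))) \<in> borel_measurable (hist k)"
    using measurable_compose[OF past_hist, of "\<lambda>t. exp (w (restrict t {..<k}))" borel]
    by (simp add: past_restrict)
  note sym = integral_exp_symmetrized_le[OF k w int_w, of l]
  \<comment> \<open>The weight is known at time \<open>k\<close>, so the conditional expectation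
    next to it may be removed under the integral. What remains is the symmetrized expression bounded
    before.\<close>
  note ce = H.real_cond_exp_intg[OF sym(1) w_hist]
  have le: "AE \<omega> in M. exp (w' (past (Suc k) \<omega>))
      \<le> exp (w (past k \<omega>)) * real_cond_exp M (hist k) (\<lambda>\<omega>. exp (?q \<omega>)) \<omega>"
    using jensen a_eq by eventually_elim (simp add: w'_def past_restrict exp_add)
  have ce_int: "integrable M (\<lambda>\<omega>. exp (w (past k \<omega>)) * real_cond_exp M (hist k) (\<lambda>\<omega>. exp (?q \<omega>)) \<omega>)"
    by (rule ce(1)) measurable
  have int_w': "integrable M (\<lambda>\<omega>. exp (w' (past (Suc k) \<omega>)))"
    using le by (intro Bochner_Integration.integrable_bound[OF ce_int]) (measurable, auto elim!: eventually_mono)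
  have "(\<integral>\<omega>. exp (w' (past (Suc k) \<omega>)) \<partial>M)
      \<le> (\<integral>\<omega>. exp (w (past k \<omega>)) * real_cond_exp M (hist k) (\<lambda>\<omega>. exp (?q \<omega>)) \<omega> \<partial>M)"
    by (rule integral_mono_AE[OF int_w' ce_int le])
  also have "\<dots> = (\<integral>\<omega>. exp (w (past k \<omega>)) * exp (?q \<omega>) \<partial>M)"
    by (rule ce(2)) measurable
  also have "\<dots> \<le> 1"
    using sym(2) le_w by simp
  finally have "(\<integral>\<omega>. exp (w' (past (Suc k) \<omega>)) \<partial>M) \<le> 1" .
  moreover have "AE \<omega> in M. w' (past (Suc k) \<omega>) = (\<Sum>j<Suc k. Z j \<omega>)"
    using w_eq a_Z by eventually_elim (simp add: w'_def past_restrict)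
  ultimately show ?case
    using w' int_w' by blast
qed

text \<open>The case \<open>k = n\<close> of the supermartingale bound: the linear terms sum to the
  centred \<open>f S\<close> by the martingale decomposition, the quadratic ones to the
  proxy.\<close>

lemma canonical_pair:
  "(\<integral>\<^sup>+ \<omega>. ennreal (exp (l * (f (S \<omega>) - expectation (\<lambda>\<omega>. f (S \<omega>)))
      - l\<^sup>2 * es_proxy M N n f X X' \<omega> / 2)) \<partial>M) \<le> 1"
proof -
  obtain w where "integrable M (\<lambda>\<omega>. exp (w (past n \<omega>)))" "(\<integral>\<omega>. exp (w (past n \<omega>)) \<partial>M) \<le> 1"
    and w: "AE \<omega> in M. w (past n \<omega>) =
      (\<Sum>j<n. l * real_cond_exp M (hist j) (\<lambda>\<eta>. f (S \<eta>) - f (S' j \<eta>)) \<omega>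
        - l\<^sup>2 / 2 * real_cond_exp M (hist j) (\<lambda>\<eta>. (f (S \<eta>) - f (S' j \<eta>))\<^sup>2) \<omega>)"
    using exp_supermartingale[OF order_refl, of l] by blast
  then have "(\<integral>\<^sup>+ \<omega>. ennreal (exp (w (past n \<omega>))) \<partial>M) \<le> 1"
    by (simp add: nn_integral_eq_integral)
  also have "(\<integral>\<^sup>+ \<omega>. ennreal (exp (w (past n \<omega>))) \<partial>M) =
     (\<integral>\<^sup>+ \<omega>. ennreal (exp (l * (f (S \<omega>) - expectation (\<lambda>\<omega>. f (S \<omega>)))
      - l\<^sup>2 * es_proxy M N n f X X' \<omega> / 2)) \<partial>M)"
  proof (rule nn_integral_cong_AE, use w martingale_decomposition in eventually_elim)
    case (elim \<omega>)
    have "w (past n \<omega>) = l * (\<Sum>j<n. real_cond_exp M (hist j) (\<lambda>\<eta>. f (S \<eta>) - f (S' j \<eta>)) \<omega>)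
        - l\<^sup>2 / 2 * es_proxy M N n f X X' \<omega>"
      unfolding elim(1) es_proxy_def by (simp only: sum_subtractf sum_distrib_left)
    then show ?case
      by (simp add: elim(2))
  qed
  finally show ?thesis .
qed

lemma es_proxy_integrable: "integrable M (es_proxy M N n f X X')"
  unfolding es_proxy_def[abs_def]
proof (rule Bochner_Integration.integrable_sum)
  fix k assume "k \<in> {..<n}"
  then have k: "k < n" by simp
  interpret H: finite_measure_subalgebra M "hist k" by (rule subalgebra_hist[OF k])
  show "integrable M (real_cond_exp M (hist k) (\<lambda>\<eta>. (f (S \<eta>) - f (S' k \<eta>))\<^sup>2))"
    by (rule H.real_cond_exp_int(1)[OF square_integrable_diff[OF k]])
qed

text \<open>The proxy is a sum of versions of conditional expectations of squares, each nonnegative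
  only off a null set; hence the almost-everywhere hypothesis on \<open>V\<close> in the deviation
  bounds.\<close>

lemma es_proxy_nonneg: "AE \<omega> in M. es_proxy M N n f X X' \<omega> \<ge> 0"
proof -
  have "AE \<omega> in M. real_cond_exp M (hist k) (\<lambda>\<eta>. (f (S \<eta>) - f (S' k \<eta>))\<^sup>2) \<omega> \<ge> 0" if k: "k < n" for k
  proof -
    interpret H: finite_measure_subalgebra M "hist k" by (rule subalgebra_hist[OF k])
    show ?thesis by (rule H.real_cond_exp_pos) auto
  qed
  then have "AE \<omega> in M. \<forall>k\<in>{..<n}. real_cond_exp M (hist k) (\<lambda>\<eta>. (f (S \<eta>) - f (S' k \<eta>))\<^sup>2) \<omega> \<ge> 0"
    by (intro AE_finite_allI) auto
  then show ?thesis
    by eventually_elim (auto simp: es_proxy_def intro!: sum_nonneg)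
qed

end

theorem theorem1:
  fixes M :: "'w measure" and N :: "nat \<Rightarrow> 'a measure" and n :: nat
    and X X' :: "nat \<Rightarrow> 'w \<Rightarrow> 'a" and f :: "(nat \<Rightarrow> 'a) \<Rightarrow> real"
  assumes "prob_space M"
    and "n \<ge> 1"
    and "\<And>i. i < n \<Longrightarrow> X i \<in> measurable M (N i)"
    and "\<And>i. i < n \<Longrightarrow> X' i \<in> measurable M (N i)"
    and "prob_space.indep_vars M (\<lambda>j. case j of Inl i \<Rightarrow> N i | Inr i \<Rightarrow> N i)
           (\<lambda>j. case j of Inl i \<Rightarrow> X i | Inr i \<Rightarrow> X' i) (Inl ` {..<n} \<union> Inr ` {..<n})"
    and "\<And>i. i < n \<Longrightarrow> distr M (N i) (X' i) = distr M (N i) (X i)"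
    and "f \<in> borel_measurable (PiM {..<n} N)"
    and "integrable M (\<lambda>\<omega>. (f (sample n X \<omega>))\<^sup>2)"
  shows
    "(\<forall>y>0. \<forall>x\<ge>2.
        measure M {\<omega> \<in> space M.
          \<bar>f (sample n X \<omega>) - (\<integral>\<eta>. f (sample n X \<eta>) \<partial>M)\<bar>
            \<le> sqrt (2 * (es_proxy M N n f X X' \<omega> + y)
                     * (1 + ln (1 + es_proxy M N n f X X' \<omega> / y) / 2) * x)}
        \<ge> 1 - exp (- x))
     \<and> (\<forall>x>0.
        measure M {\<omega> \<in> space M.
          \<bar>f (sample n X \<omega>) - (\<integral>\<eta>. f (sample n X \<eta>) \<partial>M)\<bar>
            \<le> 2 * sqrt ((es_proxy M N n f X X' \<omega> + (\<integral>\<eta>. es_proxy M N n f X X' \<eta> \<partial>M)) * x)}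
        \<ge> 1 - sqrt 2 * exp (- x))"
proof -
  interpret efron_stein_sample M N n X X' f
    using assms by (intro efron_stein_sample.intro efron_stein_sample_axioms.intro)
  let ?D = "\<lambda>\<omega>. f (sample n X \<omega>) - (\<integral>\<eta>. f (sample n X \<eta>) \<partial>M)"
  let ?V = "es_proxy M N n f X X'"
  have D: "?D \<in> borel_measurable M" and V: "?V \<in> borel_measurable M"
    using es_proxy_integrable by auto
  show ?thesis
    using canonical_pair_log_deviation[OF D V es_proxy_nonneg canonical_pair]
      canonical_pair_expectation_deviation[OF D es_proxy_integrable es_proxy_nonneg canonical_pair]
    by auto
qed

end
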